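(* Let $R$ be a commutative Noetherian ring and let $I \subseteq R$ be an ideal. Suppose that the associated graded ring $\mathrm{gr}_{I_{\mathfrak p}}(R_{\mathfrak p}) = \bigoplus_{t\ge 0} I_{\mathfrak p}^t/I_{\mathfrak p}^{t+1}$ is reduced for every $\mathfrak p \in \mathrm{Ass}(I)$. Then, for any positive rational number $u = \frac{p}{q}$ (with $p,q$ positive integers), we have $$\overline{I^{(u)}} = \left\{ f \in R \mid f^q \in \overline{I^{(\frac{p}{1})}} \right\}=\left\{ f \in R \mid f^q \in I^{(p)} \right\}=\overline{(I^{(p)})^{1/q}},$$ where $\overline{I^{(u)}}$ and $\overline{I^{(\frac p1)}}$ are the $u$-th and $p$-th rational symbolic powers of $I$, $I^{(p)}$ is the usual $p$-th symbolic power, and $\overline{(I^{(p)})^{1/q}}$ is the $\frac1q$-th rational power of the ideal $I^{(p)}$.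
   Context: $\mathrm{Ass}(I)$ denotes $\mathrm{Ass}_R(R/I)$, and $I_{\mathfrak p}=IR_{\mathfrak p}$. For an ideal $J$ of a ring, $\overline{J}$ denotes its integral closure. For a positive rational number $u=\frac pq$ ($p,q$ positive integers), the $u$-th rational power of an ideal $J\subseteq R$ is $\overline{J^u}=\{f\in R \mid f^q\in \overline{J^p}\}$, where $\overline{J^p}$ is the integral closure of $J^p$; it does not depend on the presentation of $u$. The $u$-th rational symbolic power of $I$ is $\overline{I^{(u)}}=\bigcap_{\mathfrak p\in \mathrm{Ass}(I)}(\overline{I^u}R_{\mathfrak p}\cap R)$. In this statement $\overline{I^{(u)}}$ always means this rational symbolic power (also when $u$ is an integer); for an integer exponent $p$ it is written $\overline{I^{(\frac p1)}}$. For a positive integer $p$, the symbolic power is $I^{(p)}=\bigcap_{\mathfrak p\in\mathrm{Ass}(I)}(I^pR_{\mathfrak p}\cap R)$. Here $JR_{\mathfrak p}\cap R$ denotes the preimage of $JR_{\mathfrak p}$ under $R\to R_{\mathfrak p}$. *)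

theory Defs
  imports Complex_Main "HOL-Algebra.Ring_Divisibility" "HOL-Algebra.Ideal_Product"
begin

definition ideal_power :: "('a, 'b) ring_scheme \<Rightarrow> 'a set \<Rightarrow> nat \<Rightarrow> 'a set"
  where "ideal_power R I n = I [^]\<^bsub>ideals_set R\<^esub> n"

definition integral_closure :: "('a, 'b) ring_scheme \<Rightarrow> 'a set \<Rightarrow> 'a set"
  where "integral_closure R I =
    {f \<in> carrier R. \<exists>n>0. \<exists>a :: nat \<Rightarrow> 'a.
       (\<forall>i\<in>{1..n}. a i \<in> ideal_power R I i) \<and>
       f [^]\<^bsub>R\<^esub> n \<oplus>\<^bsub>R\<^esub> (\<Oplus>\<^bsub>R\<^esub>i\<in>{1..n}. a i \<otimes>\<^bsub>R\<^esub> f [^]\<^bsub>R\<^esub> (n - i)) = \<zero>\<^bsub>R\<^esub>}"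

text \<open>The rational power is a function of the number \<open>u\<close>, not of a pair \<open>(p, q)\<close>. For an ideal
  \<open>J\<close> of a commutative ring all presentations \<open>u = p / q\<close> give the same set, so quantifying over
  them existentially makes no choice. Only \<open>u > 0\<close> is meaningful.\<close>

definition rational_power :: "('a, 'b) ring_scheme \<Rightarrow> 'a set \<Rightarrow> rat \<Rightarrow> 'a set"
  where "rational_power R J u =
    {f \<in> carrier R. \<exists>p q :: nat. 0 < p \<and> 0 < q \<and> u = of_nat p / of_nat q \<and>
       f [^]\<^bsub>R\<^esub> q \<in> integral_closure R (ideal_power R J p)}"

text \<open>Associated primes of the \<open>R\<close>-module \<open>R/I\<close>: the prime ideals that are the annihilator of some
  element of \<open>R/I\<close>, where \<open>r\<close> acts as multiplication by the coset \<open>I + r\<close>.\<close>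

definition Ass :: "('a, 'b) ring_scheme \<Rightarrow> 'a set \<Rightarrow> 'a set set"
  where "Ass R I =
    {P. primeideal P R \<and>
      (\<exists>x\<in>carrier (R Quot I).
         P = {r \<in> carrier R. (I +>\<^bsub>R\<^esub> r) \<otimes>\<^bsub>R Quot I\<^esub> x = \<zero>\<^bsub>R Quot I\<^esub>})}"

text \<open>The factor \<open>w\<close> is needed because \<open>S\<close> may contain zero divisors.\<close>

definition loc_rel :: "('a, 'b) ring_scheme \<Rightarrow> 'a set \<Rightarrow> (('a \<times> 'a) \<times> ('a \<times> 'a)) set"
  where "loc_rel R S =
    {((a, s), (b, t)). a \<in> carrier R \<and> s \<in> S \<and> b \<in> carrier R \<and> t \<in> S \<and>
       (\<exists>w\<in>S. w \<otimes>\<^bsub>R\<^esub> ((a \<otimes>\<^bsub>R\<^esub> t) \<ominus>\<^bsub>R\<^esub> (b \<otimes>\<^bsub>R\<^esub> s)) = \<zero>\<^bsub>R\<^esub>)}"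

definition loc_frac :: "('a, 'b) ring_scheme \<Rightarrow> 'a set \<Rightarrow> 'a \<Rightarrow> 'a \<Rightarrow> ('a \<times> 'a) set"
  where "loc_frac R S a s = loc_rel R S `` {(a, s)}"

text \<open>As for \<^const>\<open>rcoset_mult\<close>, the operations take the union over all representatives; for a
  multiplicative set \<open>S\<close> of a commutative ring every member of that union is the same fraction.\<close>

definition localization :: "('a, 'b) ring_scheme \<Rightarrow> 'a set \<Rightarrow> ('a \<times> 'a) set ring"
  where "localization R S =
    \<lparr>carrier = (carrier R \<times> S) // loc_rel R S,
     mult = (\<lambda>A B. \<Union>x\<in>A. \<Union>y\<in>B. loc_frac R S (fst x \<otimes>\<^bsub>R\<^esub> fst y) (snd x \<otimes>\<^bsub>R\<^esub> snd y)),
     one = loc_frac R S \<one>\<^bsub>R\<^esub> \<one>\<^bsub>R\<^esub>,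
     zero = loc_frac R S \<zero>\<^bsub>R\<^esub> \<one>\<^bsub>R\<^esub>,
     add = (\<lambda>A B. \<Union>x\<in>A. \<Union>y\<in>B.
              loc_frac R S ((fst x \<otimes>\<^bsub>R\<^esub> snd y) \<oplus>\<^bsub>R\<^esub> (fst y \<otimes>\<^bsub>R\<^esub> snd x)) (snd x \<otimes>\<^bsub>R\<^esub> snd y))\<rparr>"

definition loc_at :: "('a, 'b) ring_scheme \<Rightarrow> 'a set \<Rightarrow> ('a \<times> 'a) set ring"
  where "loc_at R P = localization R (carrier R - P)"

definition loc_map :: "('a, 'b) ring_scheme \<Rightarrow> 'a set \<Rightarrow> 'a \<Rightarrow> ('a \<times> 'a) set"
  where "loc_map R P a = loc_frac R (carrier R - P) a \<one>\<^bsub>R\<^esub>"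

text \<open>\<open>J R\<^sub>P\<close>\<close>

definition loc_ideal :: "('a, 'b) ring_scheme \<Rightarrow> 'a set \<Rightarrow> 'a set \<Rightarrow> ('a \<times> 'a) set set"
  where "loc_ideal R P J = Idl\<^bsub>loc_at R P\<^esub> (loc_map R P ` J)"

text \<open>\<open>J R\<^sub>P \<inter> R\<close>\<close>

definition loc_contraction :: "('a, 'b) ring_scheme \<Rightarrow> 'a set \<Rightarrow> 'a set \<Rightarrow> 'a set"
  where "loc_contraction R P J = {f \<in> carrier R. loc_map R P f \<in> loc_ideal R P J}"

text \<open>The intersections over \<open>Ass(I)\<close> are taken inside \<open>R\<close>, so that they are \<open>R\<close> for \<open>I = R\<close>, where
  there are no associated primes.\<close>

definition symbolic_power :: "('a, 'b) ring_scheme \<Rightarrow> 'a set \<Rightarrow> nat \<Rightarrow> 'a set"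
  where "symbolic_power R I p =
    {f \<in> carrier R. \<forall>P\<in>Ass R I. f \<in> loc_contraction R P (ideal_power R I p)}"

definition rational_symbolic_power :: "('a, 'b) ring_scheme \<Rightarrow> 'a set \<Rightarrow> rat \<Rightarrow> 'a set"
  where "rational_symbolic_power R I u =
    {f \<in> carrier R. \<forall>P\<in>Ass R I. f \<in> loc_contraction R P (rational_power R I u)}"

text \<open>An element of the associated graded ring is a finitely supported sequence whose entry of index
  \<open>t\<close> lies in \<open>I\<^sup>t/I\<^sup>t\<^sup>+\<^sup>1\<close>, that is, a coset of \<open>I\<^sup>t\<^sup>+\<^sup>1\<close> with a representative in \<open>I\<^sup>t\<close>; its zero is the
  coset \<open>I\<^sup>t\<^sup>+\<^sup>1\<close> itself. The product of \<open>a + I\<^sup>i\<^sup>+\<^sup>1\<close> and \<open>b + I\<^sup>j\<^sup>+\<^sup>1\<close>, with \<open>a \<in> I\<^sup>i\<close> and \<open>b \<in> I\<^sup>j\<close>, is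
  \<open>ab + I\<^sup>i\<^sup>+\<^sup>j\<^sup>+\<^sup>1\<close>, which is what \<^const>\<open>rcoset_mult\<close> modulo \<open>I\<^sup>i\<^sup>+\<^sup>j\<^sup>+\<^sup>1\<close> computes although its two
  arguments are cosets of larger ideals. The degree \<open>n\<close> part of a product is summed in \<open>R/I\<^sup>n\<^sup>+\<^sup>1\<close>,
  which contains \<open>I\<^sup>n/I\<^sup>n\<^sup>+\<^sup>1\<close>.\<close>

definition assoc_graded :: "('a, 'b) ring_scheme \<Rightarrow> 'a set \<Rightarrow> (nat \<Rightarrow> 'a set) ring"
  where "assoc_graded R I =
    \<lparr>carrier =
       {x. (\<forall>t. x t \<in> (\<lambda>a. ideal_power R I (Suc t) +>\<^bsub>R\<^esub> a) ` ideal_power R I t) \<and>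
           finite {t. x t \<noteq> ideal_power R I (Suc t)}},
     mult = (\<lambda>x y n.
       \<Oplus>\<^bsub>R Quot ideal_power R I (Suc n)\<^esub>i\<in>{..n}.
          rcoset_mult R (ideal_power R I (Suc n)) (x i) (y (n - i))),
     one = (\<lambda>t. ideal_power R I (Suc t) +>\<^bsub>R\<^esub> (if t = 0 then \<one>\<^bsub>R\<^esub> else \<zero>\<^bsub>R\<^esub>)),
     zero = (\<lambda>t. ideal_power R I (Suc t)),
     add = (\<lambda>x y t. x t <+>\<^bsub>R\<^esub> y t)\<rparr>"

definition reduced_ring :: "('a, 'b) ring_scheme \<Rightarrow> bool"
  where "reduced_ring R \<longleftrightarrow>
    (\<forall>x\<in>carrier R. \<forall>n :: nat. x [^]\<^bsub>R\<^esub> n = \<zero>\<^bsub>R\<^esub> \<longrightarrow> x = \<zero>\<^bsub>R\<^esub>)"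

end

theory Submission
  imports Defs
begin

text \<open>
  Fix an associated prime \<open>P\<close> of \<open>I\<close>, put \<open>A = R\<^sub>P\<close> and \<open>J = I A\<close>, and let \<open>f \<mapsto> f/1\<close> be the
  localization map. Reducedness of the associated graded ring of \<open>J\<close> says that the \<open>J\<close>-adic order is
  homogeneous: if \<open>x \<in> J\<^sup>t\<close> and \<open>x \<notin> J\<^sup>t\<^sup>+\<^sup>1\<close>, then \<open>x\<^sup>n \<notin> J\<^sup>t\<^sup>n\<^sup>+\<^sup>1\<close>
  (lemma \<open>reduced_graded_order\<close>). Raising \<open>t\<close> one step at a time, this gives two facts.

  \<^item> Every power \<open>J\<^sup>a\<close> is integrally closed (\<open>reduced_graded_integrally_closed\<close>): if \<open>x \<in> J\<^sup>t\<close>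
    with \<open>t < a\<close> satisfies an equation of integral dependence of degree \<open>n\<close> over \<open>J\<^sup>a\<close>, then all its
    lower terms lie in \<open>J\<^sup>t\<^sup>n\<^sup>+\<^sup>1\<close>, hence so does \<open>x\<^sup>n\<close>, and \<open>x \<in> J\<^sup>t\<^sup>+\<^sup>1\<close>.
  \<^item> If \<open>x\<^sup>b \<in> J\<^sup>a\<close>, then \<open>x \<in> J\<^sup>t\<close> for the least integer \<open>t \<ge> a/b\<close> (\<open>reduced_graded_root\<close>).

  Together they show that the \<open>u\<close>-th rational power of \<open>J\<close> lies in the ordinary power \<open>J\<^sup>t\<close> with
  \<open>t = \<lceil>u\<rceil>\<close> (\<open>reduced_graded_rational\<close>); in particular, \<open>J\<^sup>t\<close> being closed under addition, so
  does the ideal generated by that rational power. As integral dependence is preserved by ring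
  homomorphisms, the localization map sends the \<open>u\<close>-th rational power of \<open>I\<close> into \<open>J\<^sup>t\<close>. Therefore each of the four sets of
  the theorem equals the set of those \<open>f\<close> with \<open>f/1 \<in> (I R\<^sub>P)\<^sup>t\<close> for all \<open>P\<close>: the inclusions into it
  are the statement just made (for the fourth set, with the symbolic power, which maps into \<open>J\<^sup>p\<close>,
  in place of \<open>I\<^sup>p\<close>), and the inclusions out of it use that \<open>(f/1)\<^sup>q \<in> J\<^sup>t\<^sup>q \<subseteq> J\<^sup>p\<close>, together
  with clearing denominators, that is, \<open>f\<^sup>q/1 \<in> I\<^sup>p R\<^sub>P\<close> gives \<open>w f\<^sup>q \<in> I\<^sup>p\<close>, hence
  \<open>(w f)\<^sup>q \<in> I\<^sup>p\<close>, for some \<open>w \<notin> P\<close>.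
\<close>

section \<open>Powers of ideals\<close>

lemma ideal_power_0 [simp]: "ideal_power R J 0 = carrier R"
  by (simp add: ideal_power_def ideals_set_def)

lemma ideal_power_Suc: "ideal_power R J (Suc n) = ideal_power R J n \<cdot>\<^bsub>R\<^esub> J"
  by (simp add: ideal_power_def ideals_set_def)

context ring
begin

lemma ideal_power_ideal: "ideal J R \<Longrightarrow> ideal (ideal_power R J n) R"
  by (induct n) (simp_all add: ideal_power_Suc oneideal ideal_prod_is_ideal)

lemma ideal_power_carr: "ideal J R \<Longrightarrow> x \<in> ideal_power R J n \<Longrightarrow> x \<in> carrier R"
  by (meson ideal.Icarr ideal_power_ideal)

lemma ideal_power_subset_carrier:
  assumes "J \<subseteq> carrier R" shows "ideal_power R J n \<subseteq> carrier R"
proof (induct n)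
  case (Suc n)
  have "x \<in> carrier R" if "x \<in> ideal_power R J n \<cdot> J" for x
    using that Suc assms by (induct rule: ideal_prod.induct) auto
  then show ?case by (auto simp: ideal_power_Suc)
qed simp

lemma subset_ideal_power_1:
  assumes "J \<subseteq> carrier R" shows "J \<subseteq> ideal_power R J 1"
proof
  fix x assume x: "x \<in> J"
  then have "\<one> \<otimes> x \<in> ideal_power R J 1"
    by (simp add: ideal_power_Suc ideal_prod.prod)
  then show "x \<in> ideal_power R J 1" using x assms by auto
qed

lemma ideal_power_add:
  assumes "ideal J R"
  shows "ideal_power R J m \<cdot> ideal_power R J n = ideal_power R J (m + n)"
proof (induct n)
  case 0
  show ?case using assms by (simp add: ideal_prod_one ideal_power_ideal)
next
  case (Suc n)
  then show ?case using assms by (simp add: ideal_power_Suc ideal_power_ideal flip: ideal_prod_assoc)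
qed

lemma ideal_power_power:
  assumes "ideal J R"
  shows "ideal_power R (ideal_power R J a) i = ideal_power R J (a * i)"
  by (induct i) (simp_all add: ideal_power_Suc ideal_power_add[OF assms] add.commute)

lemma ideal_power_mult_mem:
  assumes "ideal J R" "x \<in> ideal_power R J m" "y \<in> ideal_power R J n"
  shows "x \<otimes> y \<in> ideal_power R J (m + n)"
  using ideal_prod.prod[OF assms(2,3)] ideal_power_add[OF assms(1)] by metis

lemma ideal_power_antimono:
  assumes "ideal J R" "m \<le> n"
  shows "ideal_power R J n \<subseteq> ideal_power R J m"
  using assms(2)
proof (induct n rule: dec_induct)
  case (step n)
  have "ideal_power R J (Suc n) \<subseteq> ideal_power R J n"
    using ideal_prod_inter[OF ideal_power_ideal[OF assms(1)] assms(1)] by (auto simp: ideal_power_Suc)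
  then show ?case using step by blast
qed simp

lemma ideal_power_pow_mem:
  assumes "ideal J R" "x \<in> ideal_power R J t"
  shows "x [^] n \<in> ideal_power R J (t * n)"
proof (induct n)
  case (Suc n)
  show ?case using ideal_power_mult_mem[OF assms(1) Suc assms(2)] by (simp add: add.commute)
qed simp

end

lemma (in ideal) finsum_mem:
  assumes "finite X" "\<And>i. i \<in> X \<Longrightarrow> g i \<in> I"
  shows "(\<Oplus>i\<in>X. g i) \<in> I"
  using assms
proof (induct X rule: finite_induct)
  case (insert x F)
  have "g \<in> F \<rightarrow> carrier R" "g x \<in> carrier R" using insert by auto
  then show ?case using insert by simp
qed simp

lemma (in cring) integral_closure_superset:
  assumes "J \<subseteq> carrier R" shows "J \<subseteq> integral_closure R J"
proof
  fix x assume x: "x \<in> J"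
  then have xc: "x \<in> carrier R" using assms by auto
  have "\<ominus> x = (\<ominus> \<one> \<otimes> \<one>) \<otimes> x" using xc by (simp add: l_minus)
  moreover have "(\<ominus> \<one> \<otimes> \<one>) \<otimes> x \<in> ideal_power R J 1"
    using x by (simp add: ideal_power_Suc ideal_prod.prod)
  ultimately have m: "\<ominus> x \<in> ideal_power R J 1" by simp
  \<comment> \<open>the equation \<open>x\<^sup>1 + (- x) x\<^sup>0 = 0\<close>\<close>
  have "x [^] (1::nat) \<oplus> (\<Oplus>i\<in>{1..1::nat}. (\<ominus> x) \<otimes> x [^] (1 - i)) = \<zero>"
    using xc by (simp add: r_neg)
  then show "x \<in> integral_closure R J"
    unfolding integral_closure_def using m xc
    by (intro CollectI conjI exI[of _ "1::nat"] exI[of _ "\<lambda>_. \<ominus> x"]) auto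
qed

section \<open>Reduced associated graded rings\<close>

text \<open>The homogeneous element of degree \<open>t\<close> of the associated graded ring that is represented
  by \<open>x \<in> J\<^sup>t\<close>.\<close>

definition homogeneous :: "('a, 'b) ring_scheme \<Rightarrow> 'a set \<Rightarrow> nat \<Rightarrow> 'a \<Rightarrow> nat \<Rightarrow> 'a set"
  where "homogeneous R J t x =
    (\<lambda>m. ideal_power R J (Suc m) +>\<^bsub>R\<^esub> (if m = t then x else \<zero>\<^bsub>R\<^esub>))"

lemma (in ring) coset_zero: "ideal K R \<Longrightarrow> K +> \<zero> = K"
  by (simp add: a_rcos_zero additive_subgroup.zero_closed ideal.axioms(1))

text \<open>The product of the representatives changes by
  \<open>a'b' - ab = (a' - a)b' + a(b' - b)\<close>, and both summands lie in \<open>J\<^sup>i\<^sup>+\<^sup>j\<^sup>+\<^sup>1\<close>.\<close>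

lemma (in cring) rcoset_mult_graded:
  assumes J: "ideal J R" and a: "a \<in> ideal_power R J i" and b: "b \<in> ideal_power R J j"
  shows "rcoset_mult R (ideal_power R J (Suc (i + j)))
           (ideal_power R J (Suc i) +> a) (ideal_power R J (Suc j) +> b)
         = ideal_power R J (Suc (i + j)) +> (a \<otimes> b)"
proof -
  let ?P = "ideal_power R J"
  note idl = ideal_power_ideal[OF J] and carr = ideal_power_carr[OF J]
  interpret K: ideal "?P (Suc (i + j))" R by (rule idl)
  have eq: "?P (Suc (i + j)) +> (a' \<otimes> b') = ?P (Suc (i + j)) +> (a \<otimes> b)"
    if a': "a' \<in> ?P (Suc i) +> a" and b': "b' \<in> ?P (Suc j) +> b" for a' b'
  proof -
    obtain e where e: "e \<in> ?P (Suc i)" "a' = e \<oplus> a"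
      using a' unfolding a_r_coset_def r_coset_def by auto
    obtain f where f: "f \<in> ?P (Suc j)" "b' = f \<oplus> b"
      using b' unfolding a_r_coset_def r_coset_def by auto
    note c = carr[OF a] carr[OF b] carr[OF e(1)] carr[OF f(1)]
    have "f \<in> ?P j" using f(1) ideal_power_antimono[OF J, of j "Suc j"] by auto
    then have "b' \<in> ?P j"
      using b f(2) by (simp add: additive_subgroup.a_closed idl ideal.axioms(1))
    then have "e \<otimes> b' \<in> ?P (Suc i + j)" by (intro ideal_power_mult_mem J e)
    moreover have "a \<otimes> f \<in> ?P (i + Suc j)" by (intro ideal_power_mult_mem J a f)
    ultimately have "e \<otimes> b' \<oplus> a \<otimes> f \<in> ?P (Suc (i + j))"
      by (metis K.a_closed add_Suc add_Suc_right)
    also have "e \<otimes> b' \<oplus> a \<otimes> f = a' \<otimes> b' \<ominus> a \<otimes> b"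
      unfolding e(2) f(2) using c by algebra
    finally show ?thesis
      using quotient_eq_iff_same_a_r_cos[OF idl, of "a' \<otimes> b'" "a \<otimes> b"] c e(2) f(2) by auto
  qed
  have "a \<in> ?P (Suc i) +> a" "b \<in> ?P (Suc j) +> b"
    by (meson a b carr abelian_subgroup.a_rcos_self abelian_subgroupI3 idl ideal.axioms(1) is_abelian_group)+
  then show ?thesis unfolding rcoset_mult_def using eq by blast
qed

lemma (in cring) homogeneous_mult:
  assumes J: "ideal J R" and x: "x \<in> ideal_power R J s" and y: "y \<in> ideal_power R J t"
  shows "homogeneous R J s x \<otimes>\<^bsub>assoc_graded R J\<^esub> homogeneous R J t y
         = homogeneous R J (s + t) (x \<otimes> y)"
proof
  fix m
  let ?K = "ideal_power R J (Suc m)"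
  note idl = ideal_power_ideal[OF J] and carr = ideal_power_carr[OF J]
  interpret K: ideal ?K R by (rule idl)
  interpret Q: ring "R Quot ?K" by (rule K.quotient_is_ring)
  have K0: "?K +> \<zero> = \<zero>\<^bsub>R Quot ?K\<^esub>" by (simp add: FactRing_def coset_zero[OF idl])
  have xy: "?K +> (x \<otimes> y) \<in> carrier (R Quot ?K)"
    using carr[OF x] carr[OF y] by (meson K.rcos_ring_hom m_closed ring_hom_closed)
  have if_mem: "(if Q then a else b) \<in> C" if "a \<in> C" "b \<in> C" for Q a b and C :: "'a set set"
    using that by simp
  have term_eq: "rcoset_mult R ?K (homogeneous R J s x i) (homogeneous R J t y (m - i))
      = (if s = i then if m = s + t then ?K +> (x \<otimes> y) else \<zero>\<^bsub>R Quot ?K\<^esub> else \<zero>\<^bsub>R Quot ?K\<^esub>)"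
    if i: "i \<le> m" for i
  proof -
    define a where "a = (if i = s then x else \<zero>)"
    define b where "b = (if m - i = t then y else \<zero>)"
    have ab: "a \<in> ideal_power R J i" "b \<in> ideal_power R J (m - i)"
      using x y idl by (auto simp: a_def b_def additive_subgroup.zero_closed ideal.axioms(1))
    have "rcoset_mult R ?K (homogeneous R J s x i) (homogeneous R J t y (m - i)) = ?K +> (a \<otimes> b)"
      using rcoset_mult_graded[OF J ab] i unfolding homogeneous_def a_def b_def by simp
    moreover have "a \<otimes> b = (if s = i \<and> m = s + t then x \<otimes> y else \<zero>)"
      using carr[OF x] carr[OF y] i unfolding a_def b_def by auto
    ultimately show ?thesis using K0 by auto
  qed
  have "(homogeneous R J s x \<otimes>\<^bsub>assoc_graded R J\<^esub> homogeneous R J t y) m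
      = (\<Oplus>\<^bsub>R Quot ?K\<^esub>i\<in>{..m}. rcoset_mult R ?K (homogeneous R J s x i) (homogeneous R J t y (m - i)))"
    by (simp add: assoc_graded_def)
  \<comment> \<open>only the pair of degrees \<open>(s, t)\<close> contributes, and only to degree \<open>s + t\<close>\<close>
  also have "\<dots> = (\<Oplus>\<^bsub>R Quot ?K\<^esub>i\<in>{..m}.
      if s = i then if m = s + t then ?K +> (x \<otimes> y) else \<zero>\<^bsub>R Quot ?K\<^esub> else \<zero>\<^bsub>R Quot ?K\<^esub>)"
    by (rule Q.finsum_cong'[OF refl]) (intro Pi_I if_mem xy Q.zero_closed, intro term_eq, simp)
  also have "\<dots> = (if m = s + t then ?K +> (x \<otimes> y) else \<zero>\<^bsub>R Quot ?K\<^esub>)"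
  proof (cases "m = s + t")
    case True
    then show ?thesis
      using Q.finsum_singleton[of s "{..m}" "\<lambda>_. ?K +> (x \<otimes> y)"] xy by auto
  next
    case False
    then show ?thesis by simp
  qed
  also have "\<dots> = homogeneous R J (s + t) (x \<otimes> y) m"
    unfolding homogeneous_def using K0 by auto
  finally show "(homogeneous R J s x \<otimes>\<^bsub>assoc_graded R J\<^esub> homogeneous R J t y) m
      = homogeneous R J (s + t) (x \<otimes> y) m" .
qed

lemma (in cring) homogeneous_pow:
  assumes J: "ideal J R" and x: "x \<in> ideal_power R J t"
  shows "homogeneous R J t x [^]\<^bsub>assoc_graded R J\<^esub> (n::nat) = homogeneous R J (t * n) (x [^] n)"
proof (induct n)
  case 0
  show ?case by (simp add: assoc_graded_def homogeneous_def)
next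
  case (Suc n)
  then show ?case
    using homogeneous_mult[OF J ideal_power_pow_mem[OF J x, of n] x] by (simp add: add.commute)
qed

lemma (in cring) homogeneous_carrier:
  assumes J: "ideal J R" and x: "x \<in> ideal_power R J t"
  shows "homogeneous R J t x \<in> carrier (assoc_graded R J)"
proof -
  note idl = ideal_power_ideal[OF J]
  have "{m. homogeneous R J t x m \<noteq> ideal_power R J (Suc m)} \<subseteq> {t}"
    unfolding homogeneous_def using coset_zero[OF idl] by auto
  then have "finite {m. homogeneous R J t x m \<noteq> ideal_power R J (Suc m)}"
    by (rule finite_subset) simp
  moreover have "(if m = t then x else \<zero>) \<in> ideal_power R J m" for m
    using x idl by (auto simp: additive_subgroup.zero_closed ideal.axioms(1))
  ultimately show ?thesis
    unfolding assoc_graded_def homogeneous_def by auto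
qed

lemma (in cring) homogeneous_eq_zero_iff:
  assumes J: "ideal J R" and x: "x \<in> ideal_power R J t"
  shows "homogeneous R J t x = \<zero>\<^bsub>assoc_graded R J\<^esub> \<longleftrightarrow> x \<in> ideal_power R J (Suc t)"
proof -
  note idl = ideal_power_ideal[OF J]
  have "homogeneous R J t x = \<zero>\<^bsub>assoc_graded R J\<^esub>
      \<longleftrightarrow> ideal_power R J (Suc t) +> x = ideal_power R J (Suc t)"
    unfolding assoc_graded_def homogeneous_def fun_eq_iff
    using coset_zero[OF idl] by auto
  also have "\<dots> \<longleftrightarrow> x \<in> ideal_power R J (Suc t)"
    using ideal.rcos_const_imp_mem[OF idl ideal_power_carr[OF J x]] a_rcos_zero[OF idl] by blast
  finally show ?thesis .
qed

text \<open>The class of \<open>x\<close> in degree \<open>t\<close> has as its \<open>n\<close>-th power the class of \<open>x\<^sup>n\<close> in degree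
  \<open>t n\<close>. The latter vanishes, so the former is nilpotent, hence zero.\<close>

lemma (in cring) reduced_graded_order:
  assumes J: "ideal J R" and red: "reduced_ring (assoc_graded R J)"
    and x: "x \<in> ideal_power R J t" and xn: "x [^] (n::nat) \<in> ideal_power R J (Suc (t * n))"
  shows "x \<in> ideal_power R J (Suc t)"
proof -
  have "homogeneous R J t x [^]\<^bsub>assoc_graded R J\<^esub> n = \<zero>\<^bsub>assoc_graded R J\<^esub>"
    using homogeneous_eq_zero_iff[OF J ideal_power_pow_mem[OF J x, of n]] homogeneous_pow[OF J x] xn
    by simp
  then have "homogeneous R J t x = \<zero>\<^bsub>assoc_graded R J\<^esub>"
    using red homogeneous_carrier[OF J x] unfolding reduced_ring_def by blast
  then show ?thesis using homogeneous_eq_zero_iff[OF J x] by simp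
qed

text \<open>For \<open>b > 0\<close> the condition \<open>t * b < a + b\<close> says \<open>t < a/b + 1\<close>, that is, \<open>t \<le> \<lceil>a/b\<rceil>\<close>.\<close>

lemma (in cring) reduced_graded_root:
  assumes J: "ideal J R" and red: "reduced_ring (assoc_graded R J)"
    and x: "x \<in> carrier R" and xb: "x [^] b \<in> ideal_power R J a" and "t * b < a + b"
  shows "x \<in> ideal_power R J t"
  using \<open>t * b < a + b\<close>
proof (induct t)
  case 0
  show ?case using x by simp
next
  case (Suc t)
  then have "x \<in> ideal_power R J t" and "Suc (t * b) \<le> a" by auto
  moreover have "x [^] b \<in> ideal_power R J (Suc (t * b))"
    using ideal_power_antimono[OF J \<open>Suc (t * b) \<le> a\<close>] xb by blast
  ultimately show ?case using reduced_graded_order[OF J red] by blast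
qed

lemma (in cring) reduced_graded_integrally_closed:
  assumes J: "ideal J R" and red: "reduced_ring (assoc_graded R J)"
  shows "integral_closure R (ideal_power R J a) \<subseteq> ideal_power R J a"
proof
  fix x assume "x \<in> integral_closure R (ideal_power R J a)"
  then obtain n c where x: "x \<in> carrier R" and "n > 0"
    and c: "\<And>i. i \<in> {1..n} \<Longrightarrow> c i \<in> ideal_power R (ideal_power R J a) i"
    and eq: "x [^] n \<oplus> (\<Oplus>i\<in>{1..n}. c i \<otimes> x [^] (n - i)) = \<zero>"
    unfolding integral_closure_def by blast
  have "x \<in> ideal_power R J t" if "t \<le> a" for t
    using that
  proof (induct t)
    case 0
    show ?case using x by simp
  next
    case (Suc t)
    let ?K = "ideal_power R J (Suc (t * n))"
    interpret K: ideal ?K R by (rule ideal_power_ideal[OF J])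
    have xt: "x \<in> ideal_power R J t" using Suc by simp
    have mem: "c i \<otimes> x [^] (n - i) \<in> ?K" if i: "i \<in> {1..n}" for i
    proof -
      have "c i \<otimes> x [^] (n - i) \<in> ideal_power R J (a * i + t * (n - i))"
        using c[OF i] ideal_power_power[OF J] by (intro ideal_power_mult_mem[OF J] ideal_power_pow_mem[OF J xt]) auto
      \<comment> \<open>\<open>a i + t (n - i) \<ge> (t + 1) i + t (n - i) = t n + i \<ge> t n + 1\<close>\<close>
      moreover have "Suc (t * n) \<le> a * i + t * (n - i)"
      proof -
        have "t * n = t * i + t * (n - i)" using i by (simp flip: distrib_left)
        moreover have "Suc t * i \<le> a * i" using Suc.prems by (rule mult_le_mono1)
        ultimately show ?thesis using i by simp
      qed
      ultimately show ?thesis using ideal_power_antimono[OF J] by blast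
    qed
    have S: "(\<Oplus>i\<in>{1..n}. c i \<otimes> x [^] (n - i)) \<in> ?K"
      by (rule K.finsum_mem) (use mem in auto)
    have "x [^] n = \<ominus> (\<Oplus>i\<in>{1..n}. c i \<otimes> x [^] (n - i))"
      using eq x K.Icarr[OF S] by (simp add: minus_equality a_comm)
    then have "x [^] n \<in> ?K" using S by simp
    then show ?case by (rule reduced_graded_order[OF J red xt])
  qed
  then show "x \<in> ideal_power R J a" by simp
qed

text \<open>When \<open>p / q = a / b\<close>, the hypothesis on \<open>x\<close> is membership in the rational power of exponent
  \<open>p / q\<close>, and the largest \<open>t\<close> allowed is \<open>\<lceil>p / q\<rceil>\<close>.\<close>

lemma (in cring) reduced_graded_rational:
  assumes J: "ideal J R" and red: "reduced_ring (assoc_graded R J)"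
    and x: "x \<in> carrier R" and xb: "x [^] b \<in> integral_closure R (ideal_power R J a)"
    and "0 < b" "0 < q" "a * q = p * b" "t * q < p + q"
  shows "x \<in> ideal_power R J t"
proof (rule reduced_graded_root[OF J red x])
  show "x [^] b \<in> ideal_power R J a"
    using xb reduced_graded_integrally_closed[OF J red] by blast
  have "(t * q) * b < (p + q) * b" using assms by simp
  also have "\<dots> = (a + b) * q" using \<open>a * q = p * b\<close> by (simp add: algebra_simps)
  finally have "(t * b) * q < (a + b) * q" by (simp add: mult.commute mult.left_commute)
  then show "t * b < a + b" by simp
qed

section \<open>Ideals and integral closure under ring homomorphisms\<close>

text \<open>Applied to ideals of \<open>R\<close> and, with target a power of the extended ideal, to symbolic powers.\<close>

lemma (in ring_hom_cring) hom_ideal_power: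
  assumes K: "K \<subseteq> carrier R" and KL: "h ` K \<subseteq> L" and x: "x \<in> ideal_power R K n"
  shows "h x \<in> ideal_power S L n"
  using x
proof (induct n arbitrary: x)
  case (Suc n)
  note Kn = R.ideal_power_subset_carrier[OF K, of n]
  have "x \<in> ideal_power R K n \<cdot>\<^bsub>R\<^esub> K" using Suc by (simp add: ideal_power_Suc)
  then have "x \<in> carrier R \<and> h x \<in> ideal_power S L n \<cdot>\<^bsub>S\<^esub> L"
  proof (induct rule: ideal_prod.induct)
    case (prod i j)
    then have "i \<in> carrier R" "j \<in> carrier R" using Kn K by auto
    then show ?case using prod Suc.hyps KL by (auto intro!: ideal_prod.prod)
  next
    case (sum s1 s2)
    then show ?case by (auto intro!: ideal_prod.sum)
  qed
  then show ?case by (simp add: ideal_power_Suc)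
qed simp

lemma (in ring_hom_cring) hom_integral_closure:
  assumes K: "K \<subseteq> carrier R" and KL: "h ` K \<subseteq> L" and x: "x \<in> integral_closure R K"
  shows "h x \<in> integral_closure S L"
proof -
  from x obtain n c where xc: "x \<in> carrier R" and n: "n > 0"
    and c: "\<And>i. i \<in> {1..n} \<Longrightarrow> c i \<in> ideal_power R K i"
    and eq: "x [^]\<^bsub>R\<^esub> n \<oplus>\<^bsub>R\<^esub> (\<Oplus>\<^bsub>R\<^esub>i\<in>{1..n}. c i \<otimes>\<^bsub>R\<^esub> x [^]\<^bsub>R\<^esub> (n - i)) = \<zero>\<^bsub>R\<^esub>"
    unfolding integral_closure_def by blast
  have cc: "c i \<in> carrier R" if "i \<in> {1..n}" for i
    using c[OF that] R.ideal_power_subset_carrier[OF K] by auto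
  let ?g = "\<lambda>i. c i \<otimes>\<^bsub>R\<^esub> x [^]\<^bsub>R\<^esub> (n - i)"
  have g: "?g \<in> {1..n} \<rightarrow> carrier R" using cc xc by auto
  have "\<zero>\<^bsub>S\<^esub> = h (x [^]\<^bsub>R\<^esub> n \<oplus>\<^bsub>R\<^esub> (\<Oplus>\<^bsub>R\<^esub>i\<in>{1..n}. ?g i))" using eq by simp
  also have "\<dots> = h x [^]\<^bsub>S\<^esub> n \<oplus>\<^bsub>S\<^esub> (\<Oplus>\<^bsub>S\<^esub>i\<in>{1..n}. (h \<circ> ?g) i)"
    using xc g by (simp add: ring.hom_nat_pow comp_def)
  also have "(\<Oplus>\<^bsub>S\<^esub>i\<in>{1..n}. (h \<circ> ?g) i)
      = (\<Oplus>\<^bsub>S\<^esub>i\<in>{1..n}. h (c i) \<otimes>\<^bsub>S\<^esub> h x [^]\<^bsub>S\<^esub> (n - i))"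
    by (rule S.finsum_cong') (use cc xc in \<open>auto simp: ring.hom_nat_pow\<close>)
  finally have "h x [^]\<^bsub>S\<^esub> n \<oplus>\<^bsub>S\<^esub> (\<Oplus>\<^bsub>S\<^esub>i\<in>{1..n}. h (c i) \<otimes>\<^bsub>S\<^esub> h x [^]\<^bsub>S\<^esub> (n - i)) = \<zero>\<^bsub>S\<^esub>" ..
  moreover have "h (c i) \<in> ideal_power S L i" if "i \<in> {1..n}" for i
    using hom_ideal_power[OF K KL c[OF that]] .
  ultimately show ?thesis
    unfolding integral_closure_def using xc n
    by (intro CollectI conjI exI[of _ n] exI[of _ "\<lambda>i. h (c i)"]) auto
qed

text \<open>The colon ideal \<open>(L : T)\<close>.\<close>

lemma (in cring) ideal_colon:
  assumes L: "ideal L R" and T: "T \<subseteq> carrier R"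
  shows "ideal {b \<in> carrier R. \<forall>a\<in>T. a \<otimes> b \<in> L} R"
proof -
  interpret L: ideal L R by (rule L)
  show ?thesis
  proof (rule idealI[OF ring_axioms])
    show "subgroup {b \<in> carrier R. \<forall>a\<in>T. a \<otimes> b \<in> L} (add_monoid R)"
    proof (rule add.subgroupI)
      have "\<zero> \<in> {b \<in> carrier R. \<forall>a\<in>T. a \<otimes> b \<in> L}" using T by auto
      then show "{b \<in> carrier R. \<forall>a\<in>T. a \<otimes> b \<in> L} \<noteq> {}" by blast
    qed (use T in \<open>auto simp: r_minus r_distr subset_iff simp flip: a_inv_def\<close>)
  qed (use T in \<open>auto simp: m_assoc[symmetric] L.I_r_closed subset_iff\<close>,
       metis L.I_l_closed m_lcomm m_assoc)
qed

text \<open>Membership of the product is linear in each factor, so that it may be tested on generators,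
  first in the one argument and then in the other.\<close>

lemma (in ring_hom_cring) extension_mult:
  assumes J: "J \<subseteq> carrier R" and K: "K \<subseteq> carrier R"
    and a: "a \<in> Idl\<^bsub>S\<^esub> (h ` J)" and b: "b \<in> Idl\<^bsub>S\<^esub> (h ` K)"
  shows "a \<otimes>\<^bsub>S\<^esub> b \<in> Idl\<^bsub>S\<^esub> (h ` (J \<cdot>\<^bsub>R\<^esub> K))"
proof -
  let ?L = "Idl\<^bsub>S\<^esub> (h ` (J \<cdot>\<^bsub>R\<^esub> K))"
  have JK: "J \<cdot>\<^bsub>R\<^esub> K \<subseteq> carrier R"
  proof
    fix x assume "x \<in> J \<cdot>\<^bsub>R\<^esub> K"
    then show "x \<in> carrier R" using J K by (induct rule: ideal_prod.induct) auto
  qed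
  then have hc: "h ` (J \<cdot>\<^bsub>R\<^esub> K) \<subseteq> carrier S" "h ` J \<subseteq> carrier S" "h ` K \<subseteq> carrier S"
    using J K by auto
  have L: "ideal ?L S" by (rule S.genideal_ideal[OF hc(1)])
  have gen: "h i \<otimes>\<^bsub>S\<^esub> h j \<in> ?L" if "i \<in> J" "j \<in> K" for i j
  proof -
    have "h (i \<otimes>\<^bsub>R\<^esub> j) \<in> ?L"
      using S.genideal_self[OF hc(1)] ideal_prod.prod[OF that] by blast
    then show ?thesis using that J K by (auto simp: subset_iff)
  qed
  have "Idl\<^bsub>S\<^esub> (h ` K) \<subseteq> {b \<in> carrier S. \<forall>a\<in>h ` J. a \<otimes>\<^bsub>S\<^esub> b \<in> ?L}"
    by (rule S.genideal_minimal[OF S.ideal_colon[OF L hc(2)]]) (use gen hc in auto)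
  then have bc: "b \<in> carrier S" and bJ: "\<And>a. a \<in> h ` J \<Longrightarrow> a \<otimes>\<^bsub>S\<^esub> b \<in> ?L" using b by auto
  have "Idl\<^bsub>S\<^esub> (h ` J) \<subseteq> {a \<in> carrier S. \<forall>c\<in>{b}. c \<otimes>\<^bsub>S\<^esub> a \<in> ?L}"
    by (rule S.genideal_minimal[OF S.ideal_colon[OF L]])
       (use bc bJ hc in \<open>auto simp: S.m_comm image_subset_iff subset_iff\<close>)
  then show ?thesis using a bc S.m_comm by auto
qed

lemma (in ring_hom_cring) extension_ideal_power:
  assumes J: "J \<subseteq> carrier R"
  shows "ideal_power S (Idl\<^bsub>S\<^esub> (h ` J)) n \<subseteq> Idl\<^bsub>S\<^esub> (h ` ideal_power R J n)"
proof (induct n)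
  case 0
  have "Idl\<^bsub>S\<^esub> (h ` carrier R) = carrier S"
    using S.genideal_self[of "h ` carrier R"] S.genideal_ideal[of "h ` carrier R"]
    by (metis R.one_closed hom_closed hom_one ideal.one_imp_carrier image_eqI image_subsetI subset_iff)
  then show ?case by simp
next
  case (Suc n)
  have c: "h ` ideal_power R J (Suc n) \<subseteq> carrier S"
    using R.ideal_power_subset_carrier[OF J, of "Suc n"] by auto
  show ?case
  proof
    fix x assume "x \<in> ideal_power S (Idl\<^bsub>S\<^esub> (h ` J)) (Suc n)"
    then have "x \<in> ideal_power S (Idl\<^bsub>S\<^esub> (h ` J)) n \<cdot>\<^bsub>S\<^esub> (Idl\<^bsub>S\<^esub> (h ` J))" by (simp add: ideal_power_Suc)
    then show "x \<in> Idl\<^bsub>S\<^esub> (h ` ideal_power R J (Suc n))"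
    proof (induct rule: ideal_prod.induct)
      case (prod i j)
      then have "i \<otimes>\<^bsub>S\<^esub> j \<in> Idl\<^bsub>S\<^esub> (h ` (ideal_power R J n \<cdot>\<^bsub>R\<^esub> J))"
        using Suc by (intro extension_mult[OF R.ideal_power_subset_carrier[OF J, of n] J]) blast+
      then show ?case by (simp only: ideal_power_Suc)
    next
      case (sum s1 s2)
      interpret E: ideal "Idl\<^bsub>S\<^esub> (h ` ideal_power R J (Suc n))" S by (rule S.genideal_ideal[OF c])
      show ?case using sum by (blast intro: E.a_closed)
    qed
  qed
qed

section \<open>Localization\<close>

locale multiplicative_set = cring R for R (structure) +
  fixes S
  assumes S_subset: "S \<subseteq> carrier R"
    and S_one [simp]: "\<one> \<in> S"
    and S_mult [simp]: "\<lbrakk>s \<in> S; t \<in> S\<rbrakk> \<Longrightarrow> s \<otimes> t \<in> S"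
begin

abbreviation frac where "frac \<equiv> loc_frac R S"
abbreviation Loc where "Loc \<equiv> localization R S"

lemma S_carr [simp]: "s \<in> S \<Longrightarrow> s \<in> carrier R"
  using S_subset by auto

lemma equiv_loc_rel: "equiv (carrier R \<times> S) (loc_rel R S)"
proof (rule equivI)
  show "loc_rel R S \<subseteq> (carrier R \<times> S) \<times> (carrier R \<times> S)"
    by (auto simp: loc_rel_def)
  show "refl_on (carrier R \<times> S) (loc_rel R S)"
    by (auto simp: refl_on_def loc_rel_def r_neg a_minus_def intro!: bexI[of _ \<one>])
  show "sym (loc_rel R S)"
  proof (rule symI)
    fix x y assume "(x, y) \<in> loc_rel R S"
    then obtain a s b t w where x: "x = (a, s)" "y = (b, t)" "a \<in> carrier R" "s \<in> S" "b \<in> carrier R"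
      "t \<in> S" "w \<in> S" and 0: "w \<otimes> (a \<otimes> t \<ominus> b \<otimes> s) = \<zero>"
      by (auto simp: loc_rel_def)
    have c: "a \<in> carrier R" "s \<in> carrier R" "b \<in> carrier R" "t \<in> carrier R" "w \<in> carrier R"
      using x by auto
    have "w \<otimes> (b \<otimes> s \<ominus> a \<otimes> t) = \<ominus> (w \<otimes> (a \<otimes> t \<ominus> b \<otimes> s))"
      using c by algebra
    then have "w \<otimes> (b \<otimes> s \<ominus> a \<otimes> t) = \<zero>" using 0 by simp
    then show "(y, x) \<in> loc_rel R S" using x by (auto simp: loc_rel_def)
  qed
  show "trans (loc_rel R S)"
  proof (rule transI)
    fix x y z assume "(x, y) \<in> loc_rel R S" "(y, z) \<in> loc_rel R S"
    then obtain a s b t d r w v where x: "x = (a, s)" "y = (b, t)" "z = (d, r)"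
        "a \<in> carrier R" "s \<in> S" "b \<in> carrier R" "t \<in> S" "d \<in> carrier R" "r \<in> S" "w \<in> S" "v \<in> S"
      and 0: "w \<otimes> (a \<otimes> t \<ominus> b \<otimes> s) = \<zero>" "v \<otimes> (b \<otimes> r \<ominus> d \<otimes> t) = \<zero>"
      by (auto simp: loc_rel_def)
    have c: "a \<in> carrier R" "s \<in> carrier R" "b \<in> carrier R" "t \<in> carrier R" "d \<in> carrier R"
        "r \<in> carrier R" "w \<in> carrier R" "v \<in> carrier R"
      using x by auto
    \<comment> \<open>the middle denominator \<open>t\<close> joins the two annihilating factors\<close>
    have "(w \<otimes> v \<otimes> t) \<otimes> (a \<otimes> r \<ominus> d \<otimes> s)
        = v \<otimes> r \<otimes> (w \<otimes> (a \<otimes> t \<ominus> b \<otimes> s)) \<oplus> w \<otimes> s \<otimes> (v \<otimes> (b \<otimes> r \<ominus> d \<otimes> t))"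
      using c by algebra
    also have "\<dots> = \<zero>" using 0 c by simp
    finally show "(x, z) \<in> loc_rel R S" using x
      by (auto simp: loc_rel_def intro!: bexI[of _ "w \<otimes> v \<otimes> t"])
  qed
qed

lemma frac_eq_iff:
  assumes "a \<in> carrier R" "s \<in> S" "b \<in> carrier R" "t \<in> S"
  shows "frac a s = frac b t \<longleftrightarrow> (\<exists>w\<in>S. w \<otimes> (a \<otimes> t \<ominus> b \<otimes> s) = \<zero>)"
  unfolding loc_frac_def using assms
  by (subst eq_equiv_class_iff[OF equiv_loc_rel]) (auto simp: loc_rel_def)

lemma frac_eqI:
  assumes "a \<in> carrier R" "s \<in> S" "b \<in> carrier R" "t \<in> S" and "a \<otimes> t = b \<otimes> s"
  shows "frac a s = frac b t"
proof -
  have "\<one> \<otimes> (a \<otimes> t \<ominus> b \<otimes> s) = \<zero>" using assms by (simp add: a_minus_def r_neg)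
  then show ?thesis using assms S_one by (subst frac_eq_iff) blast+
qed

lemma frac_carrier: "a \<in> carrier R \<Longrightarrow> s \<in> S \<Longrightarrow> frac a s \<in> carrier Loc"
  by (simp add: localization_def loc_frac_def quotientI)

lemma carrier_fracE:
  assumes "A \<in> carrier Loc"
  obtains a s where "a \<in> carrier R" "s \<in> S" "A = frac a s"
  using assms by (auto simp: localization_def loc_frac_def elim!: quotientE)

lemma frac_memD:
  assumes "x \<in> frac a s" "a \<in> carrier R" "s \<in> S"
  shows "fst x \<in> carrier R" "snd x \<in> S" "frac (fst x) (snd x) = frac a s"
proof -
  have r: "((a, s), x) \<in> loc_rel R S" using assms(1) by (simp add: loc_frac_def)
  then show "fst x \<in> carrier R" "snd x \<in> S" by (auto simp: loc_rel_def)
  show "frac (fst x) (snd x) = frac a s"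
    using equiv_class_eq[OF equiv_loc_rel r] by (simp add: loc_frac_def)
qed

lemma frac_self: "a \<in> carrier R \<Longrightarrow> s \<in> S \<Longrightarrow> (a, s) \<in> frac a s"
  unfolding loc_frac_def by (rule equiv_class_self[OF equiv_loc_rel]) simp

lemma frac_mult_cong:
  assumes "a \<in> carrier R" "s \<in> S" "b \<in> carrier R" "t \<in> S"
    and "a' \<in> carrier R" "s' \<in> S" "b' \<in> carrier R" "t' \<in> S"
    and "frac a s = frac a' s'" "frac b t = frac b' t'"
  shows "frac (a \<otimes> b) (s \<otimes> t) = frac (a' \<otimes> b') (s' \<otimes> t')"
proof -
  obtain w where w: "w \<in> S" "w \<otimes> (a \<otimes> s' \<ominus> a' \<otimes> s) = \<zero>"
    using assms by (subst (asm) frac_eq_iff) auto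
  obtain v where v: "v \<in> S" "v \<otimes> (b \<otimes> t' \<ominus> b' \<otimes> t) = \<zero>"
    using assms(10) by (subst (asm) frac_eq_iff) (use assms in auto)
  note c = assms(1,3,5,7) S_carr[OF assms(2)] S_carr[OF assms(4)] S_carr[OF assms(6)]
    S_carr[OF assms(8)] S_carr[OF w(1)] S_carr[OF v(1)]
  have "(w \<otimes> v) \<otimes> ((a \<otimes> b) \<otimes> (s' \<otimes> t') \<ominus> (a' \<otimes> b') \<otimes> (s \<otimes> t))
      = (v \<otimes> b \<otimes> t') \<otimes> (w \<otimes> (a \<otimes> s' \<ominus> a' \<otimes> s)) \<oplus> (w \<otimes> a' \<otimes> s) \<otimes> (v \<otimes> (b \<otimes> t' \<ominus> b' \<otimes> t))"
    using c by algebra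
  also have "\<dots> = \<zero>" using w v c by simp
  finally have "\<exists>w\<in>S. w \<otimes> ((a \<otimes> b) \<otimes> (s' \<otimes> t') \<ominus> (a' \<otimes> b') \<otimes> (s \<otimes> t)) = \<zero>"
    using w v by (intro bexI[of _ "w \<otimes> v"]) auto
  then show ?thesis using assms by (subst frac_eq_iff) auto
qed

lemma frac_add_cong:
  assumes "a \<in> carrier R" "s \<in> S" "b \<in> carrier R" "t \<in> S"
    and "a' \<in> carrier R" "s' \<in> S" "b' \<in> carrier R" "t' \<in> S"
    and "frac a s = frac a' s'" "frac b t = frac b' t'"
  shows "frac (a \<otimes> t \<oplus> b \<otimes> s) (s \<otimes> t) = frac (a' \<otimes> t' \<oplus> b' \<otimes> s') (s' \<otimes> t')"
proof -
  obtain w where w: "w \<in> S" "w \<otimes> (a \<otimes> s' \<ominus> a' \<otimes> s) = \<zero>"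
    using assms by (subst (asm) frac_eq_iff) auto
  obtain v where v: "v \<in> S" "v \<otimes> (b \<otimes> t' \<ominus> b' \<otimes> t) = \<zero>"
    using assms(10) by (subst (asm) frac_eq_iff) (use assms in auto)
  note c = assms(1,3,5,7) S_carr[OF assms(2)] S_carr[OF assms(4)] S_carr[OF assms(6)]
    S_carr[OF assms(8)] S_carr[OF w(1)] S_carr[OF v(1)]
  have "(w \<otimes> v) \<otimes> ((a \<otimes> t \<oplus> b \<otimes> s) \<otimes> (s' \<otimes> t') \<ominus> (a' \<otimes> t' \<oplus> b' \<otimes> s') \<otimes> (s \<otimes> t))
      = (v \<otimes> t \<otimes> t') \<otimes> (w \<otimes> (a \<otimes> s' \<ominus> a' \<otimes> s)) \<oplus> (w \<otimes> s \<otimes> s') \<otimes> (v \<otimes> (b \<otimes> t' \<ominus> b' \<otimes> t))"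
    using c by algebra
  also have "\<dots> = \<zero>" using w v c by simp
  finally have "\<exists>w\<in>S. w \<otimes> ((a \<otimes> t \<oplus> b \<otimes> s) \<otimes> (s' \<otimes> t') \<ominus> (a' \<otimes> t' \<oplus> b' \<otimes> s') \<otimes> (s \<otimes> t)) = \<zero>"
    using w v by (intro bexI[of _ "w \<otimes> v"]) auto
  then show ?thesis using assms by (subst frac_eq_iff) auto
qed

lemma frac_mult:
  assumes "a \<in> carrier R" "s \<in> S" "b \<in> carrier R" "t \<in> S"
  shows "frac a s \<otimes>\<^bsub>Loc\<^esub> frac b t = frac (a \<otimes> b) (s \<otimes> t)"
proof -
  have "frac (fst x \<otimes> fst y) (snd x \<otimes> snd y) = frac (a \<otimes> b) (s \<otimes> t)"
    if "x \<in> frac a s" "y \<in> frac b t" for x y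
    using assms frac_memD[OF that(1) assms(1,2)] frac_memD[OF that(2) assms(3,4)]
    by (intro frac_mult_cong) auto
  moreover have "frac a s \<noteq> {}" "frac b t \<noteq> {}"
    using assms by (auto dest: frac_self)
  ultimately show ?thesis by (simp add: localization_def)
qed

lemma frac_add:
  assumes "a \<in> carrier R" "s \<in> S" "b \<in> carrier R" "t \<in> S"
  shows "frac a s \<oplus>\<^bsub>Loc\<^esub> frac b t = frac (a \<otimes> t \<oplus> b \<otimes> s) (s \<otimes> t)"
proof -
  have "frac (fst x \<otimes> snd y \<oplus> fst y \<otimes> snd x) (snd x \<otimes> snd y) = frac (a \<otimes> t \<oplus> b \<otimes> s) (s \<otimes> t)"
    if "x \<in> frac a s" "y \<in> frac b t" for x y
    using assms frac_memD[OF that(1) assms(1,2)] frac_memD[OF that(2) assms(3,4)]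
    by (intro frac_add_cong) auto
  moreover have "frac a s \<noteq> {}" "frac b t \<noteq> {}"
    using assms by (auto dest: frac_self)
  ultimately show ?thesis by (simp add: localization_def)
qed

lemma Loc_one: "\<one>\<^bsub>Loc\<^esub> = frac \<one> \<one>" and Loc_zero: "\<zero>\<^bsub>Loc\<^esub> = frac \<zero> \<one>"
  by (simp_all add: localization_def)

lemma frac_neg:
  assumes "a \<in> carrier R" "s \<in> S"
  shows "frac (\<ominus> a) s \<oplus>\<^bsub>Loc\<^esub> frac a s = \<zero>\<^bsub>Loc\<^esub>"
proof -
  note c = assms S_carr[OF assms(2)]
  have "frac (\<ominus> a \<otimes> s \<oplus> a \<otimes> s) (s \<otimes> s) = frac \<zero> \<one>"
  proof (rule frac_eqI)
    show "(\<ominus> a \<otimes> s \<oplus> a \<otimes> s) \<otimes> \<one> = \<zero> \<otimes> (s \<otimes> s)" using c(1,3) by algebra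
  qed (use c in auto)
  then show ?thesis using c by (simp add: frac_add Loc_zero)
qed

lemma localization_cring: "cring Loc"
proof (rule cringI)
  show "abelian_group Loc"
  proof (rule abelian_groupI)
    show "\<zero>\<^bsub>Loc\<^esub> \<in> carrier Loc" by (simp add: Loc_zero frac_carrier)
  next
    fix A B assume "A \<in> carrier Loc" "B \<in> carrier Loc"
    then obtain a s b t where AB: "a \<in> carrier R" "s \<in> S" "A = frac a s" "b \<in> carrier R" "t \<in> S" "B = frac b t"
      by (elim carrier_fracE)
    note c = AB(1,4) S_carr[OF AB(2)] S_carr[OF AB(5)]
    show "A \<oplus>\<^bsub>Loc\<^esub> B \<in> carrier Loc" using AB by (simp add: frac_add frac_carrier)
    have "a \<otimes> t \<oplus> b \<otimes> s = b \<otimes> s \<oplus> a \<otimes> t" "s \<otimes> t = t \<otimes> s"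
      using c by (algebra, algebra)
    then show "A \<oplus>\<^bsub>Loc\<^esub> B = B \<oplus>\<^bsub>Loc\<^esub> A" using AB by (simp add: frac_add)
    fix D assume "D \<in> carrier Loc"
    then obtain d r where D: "d \<in> carrier R" "r \<in> S" "D = frac d r" by (elim carrier_fracE)
    note c = c D(1) S_carr[OF D(2)]
    have "(a \<otimes> t \<oplus> b \<otimes> s) \<otimes> r \<oplus> d \<otimes> (s \<otimes> t) = a \<otimes> (t \<otimes> r) \<oplus> (b \<otimes> r \<oplus> d \<otimes> t) \<otimes> s"
      using c by algebra
    moreover have "(s \<otimes> t) \<otimes> r = s \<otimes> (t \<otimes> r)" using c by algebra
    ultimately show "A \<oplus>\<^bsub>Loc\<^esub> B \<oplus>\<^bsub>Loc\<^esub> D = A \<oplus>\<^bsub>Loc\<^esub> (B \<oplus>\<^bsub>Loc\<^esub> D)"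
      using AB D by (simp add: frac_add)
  next
    fix A assume "A \<in> carrier Loc"
    then obtain a s where A: "a \<in> carrier R" "s \<in> S" "A = frac a s" by (elim carrier_fracE)
    then show "\<zero>\<^bsub>Loc\<^esub> \<oplus>\<^bsub>Loc\<^esub> A = A" by (simp add: Loc_zero frac_add)
    show "\<exists>y\<in>carrier Loc. y \<oplus>\<^bsub>Loc\<^esub> A = \<zero>\<^bsub>Loc\<^esub>"
      using A frac_neg frac_carrier by (intro bexI[of _ "frac (\<ominus> a) s"]) auto
  qed
  show "Group.comm_monoid Loc"
  proof (rule comm_monoidI)
    show "\<one>\<^bsub>Loc\<^esub> \<in> carrier Loc" by (simp add: Loc_one frac_carrier)
  next
    fix A B assume "A \<in> carrier Loc" "B \<in> carrier Loc"
    then obtain a s b t where AB: "a \<in> carrier R" "s \<in> S" "A = frac a s" "b \<in> carrier R" "t \<in> S" "B = frac b t"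
      by (elim carrier_fracE)
    show "A \<otimes>\<^bsub>Loc\<^esub> B \<in> carrier Loc" using AB by (simp add: frac_mult frac_carrier)
    show "A \<otimes>\<^bsub>Loc\<^esub> B = B \<otimes>\<^bsub>Loc\<^esub> A" using AB by (simp add: frac_mult m_comm)
    fix D assume "D \<in> carrier Loc"
    then obtain d r where D: "d \<in> carrier R" "r \<in> S" "D = frac d r" by (elim carrier_fracE)
    show "A \<otimes>\<^bsub>Loc\<^esub> B \<otimes>\<^bsub>Loc\<^esub> D = A \<otimes>\<^bsub>Loc\<^esub> (B \<otimes>\<^bsub>Loc\<^esub> D)"
      using AB D by (simp add: frac_mult m_assoc)
  next
    fix A assume "A \<in> carrier Loc"
    then obtain a s where A: "a \<in> carrier R" "s \<in> S" "A = frac a s" by (elim carrier_fracE)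
    then show "\<one>\<^bsub>Loc\<^esub> \<otimes>\<^bsub>Loc\<^esub> A = A" by (simp add: Loc_one frac_mult)
  qed
  fix A B D assume "A \<in> carrier Loc" "B \<in> carrier Loc" "D \<in> carrier Loc"
  then obtain a s b t d r where AB: "a \<in> carrier R" "s \<in> S" "A = frac a s" "b \<in> carrier R" "t \<in> S"
      "B = frac b t" "d \<in> carrier R" "r \<in> S" "D = frac d r"
    by (elim carrier_fracE)
  note c = AB(1,4,7) S_carr[OF AB(2)] S_carr[OF AB(5)] S_carr[OF AB(8)]
  have "frac ((a \<otimes> t \<oplus> b \<otimes> s) \<otimes> d) (s \<otimes> t \<otimes> r)
      = frac ((a \<otimes> d) \<otimes> (t \<otimes> r) \<oplus> (b \<otimes> d) \<otimes> (s \<otimes> r)) ((s \<otimes> r) \<otimes> (t \<otimes> r))"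
  proof (rule frac_eqI)
    show "(a \<otimes> t \<oplus> b \<otimes> s) \<otimes> d \<otimes> ((s \<otimes> r) \<otimes> (t \<otimes> r))
        = ((a \<otimes> d) \<otimes> (t \<otimes> r) \<oplus> (b \<otimes> d) \<otimes> (s \<otimes> r)) \<otimes> (s \<otimes> t \<otimes> r)"
      using c by algebra
  qed (use AB in auto)
  then show "(A \<oplus>\<^bsub>Loc\<^esub> B) \<otimes>\<^bsub>Loc\<^esub> D = A \<otimes>\<^bsub>Loc\<^esub> D \<oplus>\<^bsub>Loc\<^esub> B \<otimes>\<^bsub>Loc\<^esub> D"
    using AB by (simp add: frac_mult frac_add)
qed

lemma frac_hom: "ring_hom_cring R Loc (\<lambda>a. frac a \<one>)"
  by (intro ring_hom_cring.intro ring_hom_cring_axioms.intro is_cring localization_cring ring_hom_memI)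
     (auto simp: frac_carrier frac_mult frac_add Loc_one)

text \<open>The sum of two fractions with numerators in \<open>J\<close> has, over the common denominator, again a
  numerator in \<open>J\<close>; so the extension of \<open>J\<close> consists of single such fractions.\<close>

lemma fracs_ideal:
  assumes J: "ideal J R"
  shows "ideal {A. \<exists>a\<in>J. \<exists>s\<in>S. A = frac a s} Loc" (is "ideal ?E Loc")
proof -
  interpret J: ideal J R by (rule J)
  interpret L: cring Loc by (rule localization_cring)
  have mult: "A \<otimes>\<^bsub>Loc\<^esub> B \<in> ?E" if A': "A \<in> ?E" and B': "B \<in> carrier Loc" for A B
  proof -
    obtain a s where A: "a \<in> J" "s \<in> S" "A = frac a s" using A' by blast
    obtain b t where B: "b \<in> carrier R" "t \<in> S" "B = frac b t" using B' by (elim carrier_fracE)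
    have "A \<otimes>\<^bsub>Loc\<^esub> B = frac (a \<otimes> b) (s \<otimes> t)" using A B by (simp add: frac_mult)
    moreover have "a \<otimes> b \<in> J" "s \<otimes> t \<in> S" using A B by (auto simp: J.I_r_closed)
    ultimately show ?thesis by auto
  qed
  have sub: "?E \<subseteq> carrier Loc" by (auto simp: frac_carrier)
  show ?thesis
  proof (rule idealI[OF L.ring_axioms])
    show "subgroup ?E (add_monoid Loc)"
    proof (rule L.add.subgroupI)
      show "?E \<noteq> {}" using J.zero_closed S_one by blast
    next
      fix A assume "A \<in> ?E"
      then obtain a s where A: "a \<in> J" "s \<in> S" "A = frac a s" by auto
      then have "\<ominus>\<^bsub>Loc\<^esub> A = frac (\<ominus> a) s"
        by (intro L.minus_equality) (auto simp: frac_neg frac_carrier)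
      then show "\<ominus>\<^bsub>Loc\<^esub> A \<in> ?E" using A by auto
    next
      fix A B assume "A \<in> ?E" "B \<in> ?E"
      then obtain a s b t where AB: "a \<in> J" "s \<in> S" "A = frac a s" "b \<in> J" "t \<in> S" "B = frac b t"
        by auto
      then have "A \<oplus>\<^bsub>Loc\<^esub> B = frac (a \<otimes> t \<oplus> b \<otimes> s) (s \<otimes> t)" by (simp add: frac_add)
      moreover have "a \<otimes> t \<oplus> b \<otimes> s \<in> J" "s \<otimes> t \<in> S" using AB by (auto simp: J.I_r_closed)
      ultimately show "A \<oplus>\<^bsub>Loc\<^esub> B \<in> ?E" by auto
    qed (rule sub)
  next
    fix A B assume A: "A \<in> ?E" and B: "B \<in> carrier Loc"
    then show AB: "A \<otimes>\<^bsub>Loc\<^esub> B \<in> ?E" by (rule mult)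
    have "A \<in> carrier Loc" using sub A by (rule subsetD)
    then show "B \<otimes>\<^bsub>Loc\<^esub> A \<in> ?E" using AB by (subst L.m_comm[OF B])
  qed
qed

lemma clear_denominators:
  assumes J: "ideal J R" and f: "f \<in> carrier R" and mem: "frac f \<one> \<in> Idl\<^bsub>Loc\<^esub> ((\<lambda>a. frac a \<one>) ` J)"
  shows "\<exists>w\<in>S. w \<otimes> f \<in> J"
proof -
  interpret J: ideal J R by (rule J)
  interpret L: cring Loc by (rule localization_cring)
  have "Idl\<^bsub>Loc\<^esub> ((\<lambda>a. frac a \<one>) ` J) \<subseteq> {A. \<exists>a\<in>J. \<exists>s\<in>S. A = frac a s}"
    using S_one by (intro L.genideal_minimal[OF fracs_ideal[OF J]]) blast
  then obtain a s where a: "a \<in> J" "s \<in> S" "frac f \<one> = frac a s" using mem by auto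
  then obtain w where w: "w \<in> S" "w \<otimes> (f \<otimes> s \<ominus> a \<otimes> \<one>) = \<zero>"
    using f by (subst (asm) frac_eq_iff) auto
  note c = f J.Icarr[OF a(1)] S_carr[OF a(2)] S_carr[OF w(1)]
  have "(w \<otimes> s) \<otimes> f = w \<otimes> (f \<otimes> s \<ominus> a \<otimes> \<one>) \<oplus> w \<otimes> a" using c by algebra
  also have "\<dots> = w \<otimes> a" using w c by simp
  also have "\<dots> \<in> J" using a c by (simp add: J.I_l_closed)
  finally show ?thesis using a w by (intro bexI[of _ "w \<otimes> s"]) auto
qed

lemma mult_denominators:
  assumes T: "T \<subseteq> carrier R" and f: "f \<in> carrier R" and w: "w \<in> S" "w \<otimes> f \<in> T"
  shows "frac f \<one> \<in> Idl\<^bsub>Loc\<^esub> ((\<lambda>a. frac a \<one>) ` T)"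
proof -
  interpret L: cring Loc by (rule localization_cring)
  have T': "(\<lambda>a. frac a \<one>) ` T \<subseteq> carrier Loc" using T by (auto simp: frac_carrier)
  have "frac f \<one> = frac (\<one> \<otimes> (w \<otimes> f)) (w \<otimes> \<one>)"
    by (rule frac_eqI) (use f w in \<open>auto simp: m_comm\<close>)
  also have "\<dots> = frac \<one> w \<otimes>\<^bsub>Loc\<^esub> frac (w \<otimes> f) \<one>"
    using f w by (simp add: frac_mult)
  also have "\<dots> \<in> Idl\<^bsub>Loc\<^esub> ((\<lambda>a. frac a \<one>) ` T)"
    using L.genideal_self[OF T'] w frac_carrier[of \<one> w]
    by (intro ideal.I_l_closed[OF L.genideal_ideal[OF T']]) auto
  finally show ?thesis .
qed

end

lemma (in primeideal) complement_multiplicative: "multiplicative_set R (carrier R - I)"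
proof
  show "\<one> \<in> carrier R - I" using I_notcarr one_imp_carrier by auto
  show "s \<otimes> t \<in> carrier R - I" if "s \<in> carrier R - I" "t \<in> carrier R - I" for s t
    using that I_prime by auto
qed auto

lemma (in primeideal) loc_map_hom: "ring_hom_cring R (loc_at R I) (loc_map R I)"
  using multiplicative_set.frac_hom[OF complement_multiplicative]
  unfolding loc_at_def loc_map_def[abs_def] .

lemma (in primeideal) loc_contraction_clear:
  assumes J: "ideal J R" and f: "f \<in> loc_contraction R I J"
  obtains w where "w \<in> carrier R - I" "w \<otimes> f \<in> J"
  using multiplicative_set.clear_denominators[OF complement_multiplicative J] f that
  unfolding loc_contraction_def loc_ideal_def loc_at_def loc_map_def[abs_def] by blast

lemma (in primeideal) loc_contractionI:
  assumes "T \<subseteq> carrier R" "f \<in> carrier R" "w \<in> carrier R - I" "w \<otimes> f \<in> T"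
  shows "f \<in> loc_contraction R I T"
  using multiplicative_set.mult_denominators[OF complement_multiplicative assms] assms(2)
  unfolding loc_contraction_def loc_ideal_def loc_at_def loc_map_def[abs_def] by blast

section \<open>Rational symbolic powers\<close>

text \<open>The conditions characterise \<open>t = \<lceil>p / q\<rceil>\<close> without leaving the natural numbers.\<close>

lemma nat_ceiling_obtain:
  assumes "0 < (q::nat)"
  obtains t where "p \<le> t * q" "t * q < p + q"
proof
  have eq: "(p + q - 1) div q * q + (p + q - 1) mod q = p + q - 1" by simp
  have "(p + q - 1) mod q < q" using assms by simp
  then show "p \<le> (p + q - 1) div q * q" "(p + q - 1) div q * q < p + q"
    using eq assms by linarith+
qed

lemma rat_eq_cross_mult:
  assumes "of_nat p / of_nat q = (of_nat a / of_nat b :: rat)" "0 < q" "0 < b"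
  shows "a * q = p * b"
proof -
  have "(of_nat (a * q) :: rat) = of_nat (p * b)"
    using assms by (simp add: field_simps)
  then show ?thesis by (simp only: of_nat_eq_iff)
qed

text \<open>The local situation at one associated prime of \<open>I\<close>.\<close>

locale reduced_graded_prime = primeideal P R for P and R (structure) +
  fixes I
  assumes ideal_I: "ideal I R"
    and reduced: "reduced_ring (assoc_graded (loc_at R P) (loc_ideal R P I))"
begin

abbreviation J where "J \<equiv> loc_ideal R P I"
abbreviation \<phi> where "\<phi> \<equiv> loc_map R P"

sublocale loc: ring_hom_cring R "loc_at R P" \<phi>
  by (rule loc_map_hom)

lemma I_subset: "I \<subseteq> carrier R"
  using ideal.Icarr[OF ideal_I] by blast

lemma loc_I_subset: "\<phi> ` I \<subseteq> carrier (loc_at R P)"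
  using I_subset by auto

lemma ideal_J: "ideal J (loc_at R P)"
  unfolding loc_ideal_def by (rule loc.S.genideal_ideal[OF loc_I_subset])

lemma loc_I_J: "\<phi> ` I \<subseteq> J"
  unfolding loc_ideal_def by (rule loc.S.genideal_self[OF loc_I_subset])

text \<open>Forming powers commutes with extension: \<open>I\<^sup>n R\<^sub>P = (I R\<^sub>P)\<^sup>n\<close>.\<close>

lemma contraction_iff_power:
  assumes f: "f \<in> carrier R"
  shows "f \<in> loc_contraction R P (ideal_power R I n) \<longleftrightarrow> \<phi> f \<in> ideal_power (loc_at R P) J n"
proof -
  have "loc_ideal R P (ideal_power R I n) \<subseteq> ideal_power (loc_at R P) J n"
    unfolding loc_ideal_def[of R P "ideal_power R I n"]
    using loc.hom_ideal_power[OF I_subset loc_I_J]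
    by (intro loc.S.genideal_minimal[OF loc.S.ideal_power_ideal[OF ideal_J]]) blast
  moreover have "ideal_power (loc_at R P) J n \<subseteq> loc_ideal R P (ideal_power R I n)"
    unfolding loc_ideal_def by (rule loc.extension_ideal_power[OF I_subset])
  ultimately show ?thesis unfolding loc_contraction_def using f by blast
qed

text \<open>With \<open>K = I\<^sup>a\<close> this bounds the rational powers of \<open>I\<close>. With \<open>K\<close> a power of the symbolic power
  \<open>I\<^sup>(\<^sup>p\<^sup>)\<close>, which also maps into a power of \<open>I R\<^sub>P\<close>, it bounds the rational powers of the symbolic
  power.\<close>

lemma integral_over_power_imp:
  assumes K: "K \<subseteq> carrier R" "\<phi> ` K \<subseteq> ideal_power (loc_at R P) J a" and f: "f \<in> carrier R"
    and fb: "f [^] b \<in> integral_closure R K"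
    and "0 < b" "0 < q" "a * q = p * b" "t * q < p + q"
  shows "\<phi> f \<in> ideal_power (loc_at R P) J t"
proof (rule loc.S.reduced_graded_rational[OF ideal_J reduced])
  show "\<phi> f [^]\<^bsub>loc_at R P\<^esub> b \<in> integral_closure (loc_at R P) (ideal_power (loc_at R P) J a)"
    using loc.hom_integral_closure[OF K fb] f by (simp add: loc.ring.hom_nat_pow)
qed (use assms in auto)

text \<open>The extension of the rational power is generated by images of its elements, and these lie in
  the ideal \<open>J\<^sup>t\<close>.\<close>

lemma rational_contraction_imp:
  assumes f: "f \<in> loc_contraction R P (rational_power R I (of_nat p / of_nat q))"
    and "0 < q" "t * q < p + q"
  shows "\<phi> f \<in> ideal_power (loc_at R P) J t"
proof -
  have "\<phi> g \<in> ideal_power (loc_at R P) J t"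
    if g: "g \<in> rational_power R I (of_nat p / of_nat q)" for g
  proof -
    obtain a b where g: "g \<in> carrier R" and "0 < b"
      and e: "of_nat p / of_nat q = (of_nat a / of_nat b :: rat)"
      and gb: "g [^] b \<in> integral_closure R (ideal_power R I a)"
      using g unfolding rational_power_def by blast
    show ?thesis
      by (rule integral_over_power_imp[OF _ _ g gb \<open>0 < b\<close> \<open>0 < q\<close>
            rat_eq_cross_mult[OF e \<open>0 < q\<close> \<open>0 < b\<close>] \<open>t * q < p + q\<close>])
         (use loc.hom_ideal_power[OF I_subset loc_I_J] ideal_power_subset_carrier[OF I_subset] in auto)
  qed
  then have "loc_ideal R P (rational_power R I (of_nat p / of_nat q)) \<subseteq> ideal_power (loc_at R P) J t"
    unfolding loc_ideal_def[of R P "rational_power R I (of_nat p / of_nat q)"]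
    by (intro loc.S.genideal_minimal[OF loc.S.ideal_power_ideal[OF ideal_J]]) blast
  then show ?thesis using f unfolding loc_contraction_def by blast
qed

end

lemma (in cring) rational_powerI:
  assumes "ideal J R" "f \<in> carrier R" "f [^] q \<in> ideal_power R J p" "0 < p" "0 < q"
  shows "f \<in> rational_power R J (of_nat p / of_nat q)"
proof -
  have "f [^] q \<in> integral_closure R (ideal_power R J p)"
    using integral_closure_superset[of "ideal_power R J p"] assms(1,3) ideal_power_carr by blast
  then show ?thesis unfolding rational_power_def using assms by blast
qed

theorem theorem2p15:
  fixes R :: "('a, 'b) ring_scheme" (structure)
    and I :: "'a set" and u :: rat and p q :: nat
  assumes "cring R" and "noetherian_ring R" and "ideal I R"
    and "\<And>P. P \<in> Ass R I \<Longrightarrow> reduced_ring (assoc_graded (loc_at R P) (loc_ideal R P I))"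
    and "0 < p" and "0 < q" and "u = of_nat p / of_nat q"
  shows "rational_symbolic_power R I u
           = {f \<in> carrier R. f [^] q \<in> rational_symbolic_power R I (of_nat p / 1)} \<and>
         {f \<in> carrier R. f [^] q \<in> rational_symbolic_power R I (of_nat p / 1)}
           = {f \<in> carrier R. f [^] q \<in> symbolic_power R I p} \<and>
         {f \<in> carrier R. f [^] q \<in> symbolic_power R I p}
           = rational_power R (symbolic_power R I p) (1 / of_nat q)"
    (is "?A = ?B \<and> ?B = ?C \<and> ?C = ?D")
proof -
  interpret cring R by fact
  note p = \<open>0 < p\<close> and q = \<open>0 < q\<close> and u = \<open>u = of_nat p / of_nat q\<close> and I = \<open>ideal I R\<close>
  have loc: "reduced_graded_prime P R I" if "P \<in> Ass R I" for P
    using that assms(3,4)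
    by (auto simp: Ass_def reduced_graded_prime_def reduced_graded_prime_axioms_def)
  \<comment> \<open>\<open>t = \<lceil>p / q\<rceil>\<close>\<close>
  obtain t where t: "p \<le> t * q" "t * q < p + q" using nat_ceiling_obtain[OF q] .
  let ?J = "\<lambda>P n. ideal_power (loc_at R P) (loc_ideal R P I) n"
  let ?K = "symbolic_power R I p"
  \<comment> \<open>the common value of all four sets\<close>
  define T where "T = {f \<in> carrier R. \<forall>P\<in>Ass R I. loc_map R P f \<in> ?J P t}"
  have K: "?K \<subseteq> carrier R" by (auto simp: symbolic_power_def)
  have \<phi>K: "loc_map R P f \<in> ?J P p" if "f \<in> ?K" "P \<in> Ass R I" for f P
    using that reduced_graded_prime.contraction_iff_power[OF loc] unfolding symbolic_power_def by blast
  have "?A \<subseteq> T"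
    unfolding rational_symbolic_power_def T_def u
    using reduced_graded_prime.rational_contraction_imp[OF loc _ q t(2)] by blast
  moreover have "?B \<subseteq> T"
  proof
    fix f assume "f \<in> ?B"
    then have f: "f \<in> carrier R" and fq: "f [^] q \<in> rational_symbolic_power R I (of_nat p / of_nat 1)"
      by auto
    have "loc_map R P f \<in> ?J P t" if P: "P \<in> Ass R I" for P
    proof -
      interpret reduced_graded_prime P R I using P by (rule loc)
      have "loc_map R P (f [^] q) \<in> ?J P p"
        \<comment> \<open>exponent \<open>p / 1\<close>, whose ceiling is \<open>p\<close>\<close>
        using rational_contraction_imp[of "f [^] q" p 1 p] fq P
        unfolding rational_symbolic_power_def by auto
      then show ?thesis
        using loc.S.reduced_graded_root[OF ideal_J reduced _ _ t(2)] f by (simp add: loc.ring.hom_nat_pow)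
    qed
    then show "f \<in> T" using f unfolding T_def by blast
  qed
  moreover have "?D \<subseteq> T"
  proof
    fix f assume "f \<in> ?D"
    then obtain a b where f: "f \<in> carrier R" and b: "0 < b"
      and e: "1 / of_nat q = (of_nat a / of_nat b :: rat)"
      and fb: "f [^] b \<in> integral_closure R (ideal_power R ?K a)"
      unfolding rational_power_def by blast
    have "of_nat 1 / of_nat q = (of_nat a / of_nat b :: rat)" using e by simp
    then have "b = a * q" using rat_eq_cross_mult[of 1 q a b] q b by simp
    \<comment> \<open>the symbolic power maps into \<open>J\<^sup>p\<close>, so \<open>f\<close> has exponent \<open>p a / b = p / q\<close> over
      \<open>J = I R\<^sub>P\<close>\<close>
    then have cross: "p * a * q = p * b" by simp
    have "loc_map R P f \<in> ?J P t" if P: "P \<in> Ass R I" for P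
    proof -
      interpret reduced_graded_prime P R I using P by (rule loc)
      have "loc_map R P x \<in> ?J P (p * a)" if x: "x \<in> ideal_power R ?K a" for x
      proof -
        have "loc_map R P x \<in> ideal_power (loc_at R P) (?J P p) a"
          by (rule loc.hom_ideal_power[OF K _ x]) (use \<phi>K P in blast)
        then show ?thesis by (simp add: loc.S.ideal_power_power[OF ideal_J])
      qed
      then show ?thesis
        by (intro integral_over_power_imp[OF ideal_power_subset_carrier[OF K] _ f fb b q cross t(2)]) blast
    qed
    then show "f \<in> T" using f unfolding T_def by blast
  qed
  moreover have "T \<subseteq> ?C"
  proof
    fix f assume f: "f \<in> T"
    then have fc: "f \<in> carrier R" by (simp add: T_def)
    have "f [^] q \<in> loc_contraction R P (ideal_power R I p)" if P: "P \<in> Ass R I" for P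
    proof -
      interpret reduced_graded_prime P R I using P by (rule loc)
      have "loc_map R P (f [^] q) \<in> ?J P (t * q)"
        using f P fc loc.S.ideal_power_pow_mem[OF ideal_J] by (simp add: T_def loc.ring.hom_nat_pow)
      then have "loc_map R P (f [^] q) \<in> ?J P p"
        using loc.S.ideal_power_antimono[OF ideal_J t(1)] by blast
      then show ?thesis using contraction_iff_power fc by simp
    qed
    then show "f \<in> ?C" using fc unfolding symbolic_power_def by simp
  qed
  moreover have "?C \<subseteq> ?A"
  proof
    fix f assume "f \<in> ?C"
    then have f: "f \<in> carrier R"
      and fq: "\<And>P. P \<in> Ass R I \<Longrightarrow> f [^] q \<in> loc_contraction R P (ideal_power R I p)"
      unfolding symbolic_power_def by auto
    have "f \<in> loc_contraction R P (rational_power R I u)" if P: "P \<in> Ass R I" for P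
    proof -
      interpret reduced_graded_prime P R I using P by (rule loc)
      obtain w where w: "w \<in> carrier R - P" "w \<otimes> f [^] q \<in> ideal_power R I p"
        using loc_contraction_clear[OF ideal_power_ideal[OF I] fq[OF P]] .
      \<comment> \<open>the denominator of \<open>f\<^sup>q\<close> already clears \<open>f\<close> itself, at the level of rational powers\<close>
      have "(w \<otimes> f) [^] q = w [^] (q - 1) \<otimes> w \<otimes> f [^] q"
        using w f q by (metis (no_types) DiffD1 Suc_diff_1 nat_pow_Suc nat_pow_distrib)
      also have "\<dots> = w [^] (q - 1) \<otimes> (w \<otimes> f [^] q)" using w f by (simp add: m_assoc)
      also have "\<dots> \<in> ideal_power R I p"
        by (rule ideal.I_l_closed[OF ideal_power_ideal[OF I] w(2)]) (use w in auto)
      finally have "w \<otimes> f \<in> rational_power R I u"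
        unfolding u using w f by (intro rational_powerI[OF I _ _ p q]) auto
      then show ?thesis
        using w f by (intro loc_contractionI[of _ _ w]) (auto simp: rational_power_def)
    qed
    then show "f \<in> ?A" using f unfolding rational_symbolic_power_def by blast
  qed
  moreover have "?C \<subseteq> ?B"
  proof -
    have "?K \<subseteq> rational_symbolic_power R I (of_nat p / of_nat 1)"
    proof
      fix g assume g: "g \<in> ?K"
      have "g \<in> loc_contraction R P (rational_power R I (of_nat p / of_nat 1))" if P: "P \<in> Ass R I" for P
      proof -
        interpret reduced_graded_prime P R I using P by (rule loc)
        obtain w where w: "w \<in> carrier R - P" "w \<otimes> g \<in> ideal_power R I p"
          using loc_contraction_clear[OF ideal_power_ideal[OF I]] g P unfolding symbolic_power_def by blast
        then have "w \<otimes> g \<in> rational_power R I (of_nat p / of_nat 1)"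
          using K g p by (intro rational_powerI[OF I]) auto
        then show ?thesis
          using w K g by (intro loc_contractionI[of _ _ w]) (auto simp: rational_power_def)
      qed
      then show "g \<in> rational_symbolic_power R I (of_nat p / of_nat 1)"
        using K g unfolding rational_symbolic_power_def by blast
    qed
    then show ?thesis by auto
  qed
  moreover have "?C \<subseteq> ?D"
  proof
    fix f assume "f \<in> ?C"
    then have f: "f \<in> carrier R" "f [^] q \<in> ?K" by auto
    then have "f [^] q \<in> integral_closure R (ideal_power R ?K 1)"
      using subset_ideal_power_1[OF K] integral_closure_superset[OF ideal_power_subset_carrier[OF K, of 1]]
      by blast
    moreover have "(1 / of_nat q :: rat) = of_nat 1 / of_nat q" by simp
    ultimately show "f \<in> ?D" unfolding rational_power_def using f q by blast
  qed
  ultimately show ?thesis by blast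
qed

end
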